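(* Let $Y$ be a pointed topological space containing more than one point, and let $X$ be a topological space containing an isolated point. The following conditions are equivalent: (1) the function space $C_k'(X,Y)$ is metrizable; (2) the space $Y$ is metrizable and $X$ is a hemi-$\dot\kappa_\omega$-space.
   Context: A point $x\in X$ is isolated if $\{x\}$ is clopen in $X$; $\dot X$ is the set of isolated points of $X$ and $X'=X\setminus\dot X$. A pointed space is a topological space $Y$ with a distinguished point $*_Y$. $C_k(X,Y)$ is the space of continuous functions $X\to Y$ with the compact-open topology (subbase: $\{f:f(K)\subset U\}$, $K\subset X$ compact, $U\subset Y$ open), and $C_k'(X,Y)=\{f\in C_k(X,Y):f(X')\subset\{*_Y\}\}$ with the subspace topology. $X$ is a hemi-$\dot\kappa_\omega$-space if there is a countable family $\{K_n\}_{n\in\omega}$ of compact subsets of $X$ such that for any compact $K\subset X$ there is $n\in\omega$ with $K\cap\dot X\subset K_n$. *)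

theory Defs
  imports "HOL-Analysis.Analysis"
begin

text \<open>Note that isolated points are required to be clopen, not merely open, as singletons;
  no separation axiom is assumed, so the two may differ.\<close>

definition isolated_points :: "'a topology \<Rightarrow> 'a set"
  where "isolated_points X = {x. openin X {x} \<and> closedin X {x}}"

definition nonisolated_points :: "'a topology \<Rightarrow> 'a set"
  where "nonisolated_points X = topspace X - isolated_points X"

text \<open>A continuous function on \<open>X\<close> is represented by its unique representative that is
  \<^const>\<open>undefined\<close> outside \<^term>\<open>topspace X\<close>.\<close>

definition continuous_maps :: "'a topology \<Rightarrow> 'b topology \<Rightarrow> ('a \<Rightarrow> 'b) set"
  where "continuous_maps X Y = {f \<in> extensional (topspace X). continuous_map X Y f}"

definition compact_open_topology :: "'a topology \<Rightarrow> 'b topology \<Rightarrow> ('a \<Rightarrow> 'b) topology"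
  where "compact_open_topology X Y =
    topology_generated_by
      {{f \<in> continuous_maps X Y. f ` K \<subseteq> U} | K U. compactin X K \<and> openin Y U}"

lemma topspace_compact_open_topology [simp]:
  "topspace (compact_open_topology X Y) = continuous_maps X Y"
proof -
  have "continuous_maps X Y \<in>
      {{f \<in> continuous_maps X Y. f ` K \<subseteq> U} | K U. compactin X K \<and> openin Y U}"
    by (rule CollectI, rule exI[of _ "{}"], rule exI[of _ "{}"]) auto
  then show ?thesis
    unfolding compact_open_topology_def topology_generated_by_topspace by blast
qed

text \<open>The space \<open>C\<^sub>k'(X,Y)\<close>, where \<open>p\<close> is the distinguished point of \<open>Y\<close>.\<close>

definition pointed_function_space :: "'a topology \<Rightarrow> 'b topology \<Rightarrow> 'b \<Rightarrow> ('a \<Rightarrow> 'b) topology"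
  where "pointed_function_space X Y p =
    subtopology (compact_open_topology X Y)
      {f \<in> continuous_maps X Y. f ` nonisolated_points X \<subseteq> {p}}"

definition hemi_dot_kappa_omega_space :: "'a topology \<Rightarrow> bool"
  where "hemi_dot_kappa_omega_space X \<longleftrightarrow>
    (\<exists>K :: nat \<Rightarrow> 'a set. (\<forall>n. compactin X (K n)) \<and>
      (\<forall>L. compactin X L \<longrightarrow> (\<exists>n. L \<inter> isolated_points X \<subseteq> K n)))"

end

theory Submission
  imports Defs
begin

text \<open>Functions in \<open>C\<^sub>k'(X,Y)\<close> all agree on \<open>X'\<close>, so only the traces of compact sets on the set of
  isolated points matter for the compact-open topology. Countably many compact sets \<open>K n\<close> that
  cover these traces therefore give a metric: the supremum over \<open>n\<close> of the uniform distance on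
  \<open>K n\<close> truncated at \<open>1 / (n + 1)\<close>.

  Conversely, \<open>Y\<close> is a retract of \<open>C\<^sub>k'(X,Y)\<close> under evaluation at an isolated point. Every
  neighbourhood of the constant function \<open>p\<close> leaves the values outside some compact set
  unrestricted. Since a function may take a value \<open>q \<noteq> p\<close> at a single isolated point only, the
  compact sets obtained from a countable neighbourhood base absorb the isolated points of every
  compact set.\<close>

section \<open>Metrics of uniform convergence on a sequence of sets\<close>

text \<open>The inserted 0 keeps the set nonempty when every \<open>K n\<close> is empty. Truncation
  bounds the set even if \<open>d\<close> is unbounded, and all indices beyond a suitable
  \<open>N\<close> contribute less than any prescribed positive amount.\<close>

definition truncated_sup_dist ::
    "('b \<Rightarrow> 'b \<Rightarrow> real) \<Rightarrow> (nat \<Rightarrow> 'a set) \<Rightarrow> ('a \<Rightarrow> 'b) \<Rightarrow> ('a \<Rightarrow> 'b) \<Rightarrow> real"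
  where "truncated_sup_dist d K f g =
    Sup (insert 0 {min (inverse (real (Suc n))) (d (f x) (g x)) | n x. x \<in> K n})"

lemma truncated_sup_dist_bdd_above:
  "bdd_above (insert 0 {min (inverse (real (Suc n))) (d (f x) (g x)) | n x. x \<in> K n})"
proof (rule bdd_aboveI[where M = 1])
  fix r
  assume "r \<in> insert 0 {min (inverse (real (Suc n))) (d (f x) (g x)) | n x. x \<in> K n}"
  moreover have "min (inverse (real (Suc n))) s \<le> 1" for n s
    by (rule min.coboundedI1) (simp add: divide_simps)
  ultimately show "r \<le> 1"
    by auto
qed

lemma truncated_sup_dist_upper:
  "x \<in> K n \<Longrightarrow> min (inverse (real (Suc n))) (d (f x) (g x)) \<le> truncated_sup_dist d K f g"
  unfolding truncated_sup_dist_def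
  by (rule cSup_upper[OF _ truncated_sup_dist_bdd_above]) blast

lemma truncated_sup_dist_nonneg: "0 \<le> truncated_sup_dist d K f g"
  unfolding truncated_sup_dist_def
  by (rule cSup_upper[OF _ truncated_sup_dist_bdd_above]) blast

lemma truncated_sup_dist_least:
  assumes "0 \<le> B"
    and "\<And>n x. x \<in> K n \<Longrightarrow> min (inverse (real (Suc n))) (d (f x) (g x)) \<le> B"
  shows "truncated_sup_dist d K f g \<le> B"
  unfolding truncated_sup_dist_def by (rule cSup_least) (use assms in auto)

text \<open>The truncation levels are positive, so distance 0 forces equality on every
  \<open>K n\<close>, and \<open>separating\<close> turns this into equality of maps. The triangle
  inequality holds termwise, since truncation at a nonnegative level is subadditive on nonnegative
  reals.\<close>

lemma (in Metric_space) Metric_space_truncated_sup_dist: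
  assumes range: "\<And>f n x. f \<in> C \<Longrightarrow> x \<in> K n \<Longrightarrow> f x \<in> M"
    and separating: "\<And>f g. f \<in> C \<Longrightarrow> g \<in> C \<Longrightarrow> (\<And>n x. x \<in> K n \<Longrightarrow> f x = g x) \<Longrightarrow> f = g"
  shows "Metric_space C (truncated_sup_dist d K)"
proof
  fix f g :: "'b \<Rightarrow> 'a"
  show "0 \<le> truncated_sup_dist d K f g"
    by (rule truncated_sup_dist_nonneg)
  show "truncated_sup_dist d K f g = truncated_sup_dist d K g f"
    unfolding truncated_sup_dist_def by (simp add: commute)
next
  fix f g
  assume fg: "f \<in> C" "g \<in> C"
  show "truncated_sup_dist d K f g = 0 \<longleftrightarrow> f = g"
  proof
    assume zero_dist: "truncated_sup_dist d K f g = 0"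
    show "f = g"
    proof (rule separating[OF fg])
      fix n x
      assume x: "x \<in> K n"
      have "min (inverse (real (Suc n))) (d (f x) (g x)) \<le> 0"
        using truncated_sup_dist_upper[of x K n d f g] x zero_dist by simp
      then have "d (f x) (g x) = 0"
        using nonneg[of "f x" "g x"] by (auto simp: min_le_iff_disj simp del: nonneg)
      then show "f x = g x"
        using range fg x by (metis zero)
    qed
  next
    assume "f = g"
    then have "truncated_sup_dist d K f g \<le> 0"
      by (intro truncated_sup_dist_least) (use range fg in auto)
    then show "truncated_sup_dist d K f g = 0"
      using truncated_sup_dist_nonneg by (metis order_antisym)
  qed
next
  fix f g h
  assume fgh: "f \<in> C" "g \<in> C" "h \<in> C"
  show "truncated_sup_dist d K f h \<le> truncated_sup_dist d K f g + truncated_sup_dist d K g h"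
  proof (rule truncated_sup_dist_least)
    show "0 \<le> truncated_sup_dist d K f g + truncated_sup_dist d K g h"
      by (simp add: truncated_sup_dist_nonneg)
    fix n x
    assume x: "x \<in> K n"
    have "d (f x) (h x) \<le> d (f x) (g x) + d (g x) (h x)"
      using range fgh x by (intro triangle) auto
    moreover have "0 \<le> inverse (real (Suc n))"
      by simp
    ultimately have "min (inverse (real (Suc n))) (d (f x) (h x))
        \<le> min (inverse (real (Suc n))) (d (f x) (g x))
          + min (inverse (real (Suc n))) (d (g x) (h x))"
      using nonneg[of "f x" "g x"] nonneg[of "g x" "h x"] unfolding min_def by (smt (verit))
    also have "\<dots> \<le> truncated_sup_dist d K f g + truncated_sup_dist d K g h"
      by (intro add_mono truncated_sup_dist_upper x)
    finally show "min (inverse (real (Suc n))) (d (f x) (h x))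
        \<le> truncated_sup_dist d K f g + truncated_sup_dist d K g h" .
  qed
qed

text \<open>A Lebesgue number argument: finitely many balls of half the admissible radius cover
  \<open>S\<close>, and the least of these half radii serves for all points of \<open>S\<close> at
  once.\<close>

lemma (in Metric_space) compactin_mball_nbhd:
  assumes "compactin mtopology S" "openin mtopology U" "S \<subseteq> U"
  obtains e where "e > 0" "\<And>x. x \<in> S \<Longrightarrow> mball x e \<subseteq> U"
proof -
  have SM: "S \<subseteq> M"
    using compactin_subset_topspace[OF assms(1)] by simp
  have "\<forall>x\<in>S. \<exists>r>0. mball x (2 * r) \<subseteq> U"
  proof
    fix x assume "x \<in> S"
    then obtain r where "r > 0" "mball x r \<subseteq> U"
      using assms(2,3) unfolding openin_mtopology by blast
    then show "\<exists>r>0. mball x (2 * r) \<subseteq> U"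
      by (intro exI[of _ "r / 2"]) auto
  qed
  then obtain r where r: "\<And>x. x \<in> S \<Longrightarrow> r x > 0" "\<And>x. x \<in> S \<Longrightarrow> mball x (2 * r x) \<subseteq> U"
    by metis
  have "x \<in> mball x (r x)" if "x \<in> S" for x
    using r(1)[OF that] SM that by auto
  then have "\<exists>F. finite F \<and> F \<subseteq> (\<lambda>x. mball x (r x)) ` S \<and> S \<subseteq> \<Union>F"
    by (intro compactinD[OF assms(1)]) (blast, blast)
  then obtain F where F: "finite F" "F \<subseteq> (\<lambda>x. mball x (r x)) ` S" "S \<subseteq> \<Union>F"
    by blast
  then obtain T where T: "finite T" "T \<subseteq> S" "S \<subseteq> (\<Union>x\<in>T. mball x (r x))"
    using finite_subset_image[OF F(1,2)] by blast
  \<comment> \<open>The inserted 1 keeps \<open>Min\<close> defined when \<open>T\<close> is empty,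
    as may happen for empty \<open>S\<close>.\<close>
  define e where "e = Min (insert 1 (r ` T))"
  have "e > 0"
    unfolding e_def using T(1,2) r(1) by (subst Min_gr_iff) auto
  moreover have "mball x e \<subseteq> U" if x: "x \<in> S" for x
  proof -
    obtain t where t: "t \<in> T" "x \<in> mball t (r t)"
      using T x by blast
    have "e \<le> r t"
      unfolding e_def using T t by (intro Min_le) auto
    then have "mball x e \<subseteq> mball t (2 * r t)"
      using t by (intro mball_subset) (auto simp: commute)
    then show ?thesis
      using r T t by blast
  qed
  ultimately show thesis
    using that by blast
qed

section \<open>The compact-open topology\<close>

lemma openin_compact_open_subbase:
  "\<lbrakk>compactin X K; openin Y U\<rbrakk> \<Longrightarrow>
    openin (compact_open_topology X Y) {f \<in> continuous_maps X Y. f ` K \<subseteq> U}"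
  unfolding compact_open_topology_def by (rule topology_generated_by_Basis) blast

text \<open>Induction over the generation of \<open>V\<close>: a subbasic set is supported on its
  own \<open>K\<close>, an intersection on the union of two supports, and a union on the support of
  a member containing \<open>f\<close>. This is what extracts compact sets from a neighbourhood
  base.\<close>

lemma openin_compact_open_imp_compact_support:
  assumes "openin (compact_open_topology X Y) V" "f \<in> V"
  shows "\<exists>K. compactin X K \<and>
    (\<forall>g\<in>continuous_maps X Y. (\<forall>x\<in>K. g x = f x) \<longrightarrow> g \<in> V)"
proof -
  have "generate_topology_on
      {{f \<in> continuous_maps X Y. f ` K \<subseteq> U} | K U. compactin X K \<and> openin Y U} V"
    using assms(1) unfolding compact_open_topology_def by (rule openin_topology_generated_by)
  then show ?thesis
    using assms(2)
  proof (induction arbitrary: f)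
    case Empty
    then show ?case by simp
  next
    case (Int a b)
    obtain K where K: "compactin X K"
      "\<forall>g\<in>continuous_maps X Y. (\<forall>x\<in>K. g x = f x) \<longrightarrow> g \<in> a"
      using Int.IH(1) Int.prems by blast
    obtain L where L: "compactin X L"
      "\<forall>g\<in>continuous_maps X Y. (\<forall>x\<in>L. g x = f x) \<longrightarrow> g \<in> b"
      using Int.IH(2) Int.prems by blast
    show ?case
      using K L by (intro exI[of _ "K \<union> L"]) (auto simp: compactin_Un)
  next
    case (UN K)
    then show ?case by (meson UnionE UnionI)
  next
    case (Basis s)
    then obtain K U where "compactin X K" "s = {f \<in> continuous_maps X Y. f ` K \<subseteq> U}"
      by blast
    then show ?case
      using Basis.prems by (intro exI[of _ K]) (auto simp: image_subset_iff)
  qed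
qed

text \<open>The compact-open topology controls uniform distance on \<open>K\<close>: cover
  \<open>f\<close> K\<open>by finitely many balls of radius\<close>e /
  3\<open>and split\<close>K\<open>into the pieces\<close>L
  y\<open>that\<close>f\<open>maps into the closed balls. These are compact, and requiring\<close>g
  \<open>L y\<close> to lie in the ball of radius \<open>2 * e / 3\<close> gives the bound by the
  triangle inequality.\<close>

lemma (in Metric_space) uniform_nbhd_compact_open:
  assumes f: "f \<in> continuous_maps X mtopology" and K: "compactin X K" and "e > 0"
  obtains V where "openin (compact_open_topology X mtopology) V" "f \<in> V"
    "\<And>g x. g \<in> V \<Longrightarrow> x \<in> K \<Longrightarrow> d (f x) (g x) < e"
proof -
  have contf: "continuous_map X mtopology f"
    using f by (simp add: continuous_maps_def)
  have KX: "K \<subseteq> topspace X"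
    using K by (rule compactin_subset_topspace)
  have fM: "f x \<in> M" if "x \<in> K" for x
    using contf KX that by (auto simp: continuous_map_def)
  define a where "a = e / 3"
  have "a > 0"
    using \<open>e > 0\<close> by (simp add: a_def)
  have "compactin mtopology (f ` K)"
    using K contf by (rule image_compactin)
  then have "\<exists>F. finite F \<and> F \<subseteq> (\<lambda>y. mball y a) ` (f ` K) \<and> f ` K \<subseteq> \<Union>F"
    using fM \<open>a > 0\<close> by (intro compactinD) auto
  then obtain T where T: "finite T" "T \<subseteq> f ` K" "f ` K \<subseteq> (\<Union>y\<in>T. mball y a)"
    by (metis finite_subset_image)
  define L where "L y = K \<inter> {x \<in> topspace X. f x \<in> mcball y a}" for y
  have L: "compactin X (L y)" for y
    unfolding L_def using K contf
    by (intro compact_Int_closedin closedin_continuous_map_preimage) auto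
  \<comment> \<open>For empty \<open>T\<close> the indexed intersection is \<open>UNIV\<close>; the
    first factor then makes \<open>V\<close> the whole space.\<close>
  define V where "V = continuous_maps X mtopology \<inter>
    (\<Inter>y\<in>T. {g \<in> continuous_maps X mtopology. g ` L y \<subseteq> mball y (2 * a)})"
  show thesis
  proof
    show "openin (compact_open_topology X mtopology) V"
    proof (cases "T = {}")
      case True
      then show ?thesis
        using openin_topspace[of "compact_open_topology X mtopology"] by (simp add: V_def)
    next
      case False
      have "openin (compact_open_topology X mtopology)
          (\<Inter>y\<in>T. {g \<in> continuous_maps X mtopology. g ` L y \<subseteq> mball y (2 * a)})"
        using T False L by (intro openin_INT2 openin_compact_open_subbase) auto
      then show ?thesis
        using openin_Int[OF openin_topspace] by (fastforce simp: V_def)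
    qed
    show "f \<in> V"
      unfolding V_def L_def using f \<open>a > 0\<close> by auto
    fix g x
    assume g: "g \<in> V" and x: "x \<in> K"
    obtain y where y: "y \<in> T" "f x \<in> mball y a"
      using T x by blast
    have "x \<in> L y"
      unfolding L_def using x y KX by auto
    then have "g x \<in> mball y (2 * a)"
      using g y unfolding V_def by blast
    then have "d (f x) (g x) \<le> d (f x) y + d y (g x)"
      using y by (intro triangle) auto
    moreover have "d y (g x) < 2 * a" "d (f x) y < a"
      using y \<open>g x \<in> mball y (2 * a)\<close> by (auto simp: commute)
    ultimately show "d (f x) (g x) < e"
      by (simp add: a_def)
  qed
qed

section \<open>Pointed function spaces\<close>

definition pointed_maps :: "'a topology \<Rightarrow> 'b topology \<Rightarrow> 'b \<Rightarrow> ('a \<Rightarrow> 'b) set"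
  where "pointed_maps X Y p = {f \<in> continuous_maps X Y. f ` nonisolated_points X \<subseteq> {p}}"

lemma pointed_function_space_eq:
  "pointed_function_space X Y p = subtopology (compact_open_topology X Y) (pointed_maps X Y p)"
  by (simp add: pointed_function_space_def pointed_maps_def)

lemma pointed_maps_subset: "pointed_maps X Y p \<subseteq> continuous_maps X Y"
  by (auto simp: pointed_maps_def)

lemma topspace_pointed_function_space [simp]:
  "topspace (pointed_function_space X Y p) = pointed_maps X Y p"
  using pointed_maps_subset by (fastforce simp: pointed_function_space_eq)

lemma isolated_points_subset: "isolated_points X \<subseteq> topspace X"
  unfolding isolated_points_def using openin_subset by fastforce

definition bump :: "'a topology \<Rightarrow> 'b \<Rightarrow> 'a \<Rightarrow> 'b \<Rightarrow> 'a \<Rightarrow> 'b"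
  where "bump X p x y = restrict (\<lambda>z. if z = x then y else p) (topspace X)"

text \<open>Continuity rests on \<open>{x}\<close> being clopen: every preimage of an open set is a
  union of some of \<open>{x}\<close> and its complement, both open.\<close>

lemma bump_in_pointed_maps:
  assumes p: "p \<in> topspace Y" and x: "x \<in> isolated_points X" and y: "y \<in> topspace Y"
  shows "bump X p x y \<in> pointed_maps X Y p"
proof -
  have clopen: "openin X {x}" "openin X (topspace X - {x})"
    using x by (auto simp: isolated_points_def)
  have "continuous_map X Y (bump X p x y)"
    unfolding continuous_map_def
  proof (intro conjI allI impI)
    show "bump X p x y \<in> topspace X \<rightarrow> topspace Y"
      using p y by (auto simp: bump_def)
    fix U assume "openin Y U"
    have "{z \<in> topspace X. bump X p x y z \<in> U} =
        (if y \<in> U then {x} else {}) \<union> (if p \<in> U then topspace X - {x} else {})"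
      using x isolated_points_subset[of X] by (auto simp: bump_def)
    also have "openin X \<dots>"
      using clopen by (intro openin_Un) auto
    finally show "openin X {z \<in> topspace X. bump X p x y z \<in> U}" .
  qed
  then show ?thesis
    using x by (auto simp: pointed_maps_def continuous_maps_def bump_def nonisolated_points_def)
qed

text \<open>Evaluation at \<open>x\<close> is a retraction with section \<open>bump X p x\<close>,
  and retracts of metrizable spaces are metrizable.\<close>

lemma metrizable_pointed_imp_metrizable_target:
  assumes p: "p \<in> topspace Y" and x: "x \<in> isolated_points X"
    and metr: "metrizable_space (pointed_function_space X Y p)"
  shows "metrizable_space Y"
proof -
  have xX: "x \<in> topspace X"
    using x isolated_points_subset[of X] by blast
  have eval: "continuous_map (pointed_function_space X Y p) Y (\<lambda>f. f x)"
    unfolding continuous_map_def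
  proof (intro conjI allI impI)
    show "(\<lambda>f. f x) \<in> topspace (pointed_function_space X Y p) \<rightarrow> topspace Y"
      using xX by (auto simp: pointed_maps_def continuous_maps_def continuous_map_def)
    fix U assume U: "openin Y U"
    have "openin (pointed_function_space X Y p)
        (pointed_maps X Y p \<inter> {f \<in> continuous_maps X Y. f ` {x} \<subseteq> U})"
      unfolding pointed_function_space_eq using U xX
      by (intro openin_subtopology_Int2 openin_compact_open_subbase) auto
    also have "pointed_maps X Y p \<inter> {f \<in> continuous_maps X Y. f ` {x} \<subseteq> U} =
        {f \<in> topspace (pointed_function_space X Y p). f x \<in> U}"
      using pointed_maps_subset by fastforce
    finally show "openin (pointed_function_space X Y p)
        {f \<in> topspace (pointed_function_space X Y p). f x \<in> U}" .
  qed
  have "continuous_map Y (compact_open_topology X Y) (bump X p x)"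
    unfolding compact_open_topology_def
  proof (rule continuous_on_generated_topo)
    fix V
    assume "V \<in> {{f \<in> continuous_maps X Y. f ` K \<subseteq> U} | K U. compactin X K \<and> openin Y U}"
    then obtain K U where V: "V = {f \<in> continuous_maps X Y. f ` K \<subseteq> U}"
      and K: "compactin X K" and U: "openin Y U"
      by blast
    have "K \<subseteq> topspace X"
      using K by (rule compactin_subset_topspace)
    \<comment> \<open>Only the second conjunct depends on \<open>y\<close>, so the preimage of a
      subbasic set is empty, \<open>U\<close> or all of \<open>Y\<close>.\<close>
    then have "bump X p x y ` K \<subseteq> U \<longleftrightarrow> (K \<subseteq> {x} \<or> p \<in> U) \<and> (x \<in> K \<longrightarrow> y \<in> U)" for y
      by (auto simp: bump_def image_subset_iff split: if_splits)
    moreover have "bump X p x y \<in> continuous_maps X Y" if "y \<in> topspace Y" for y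
      using bump_in_pointed_maps[OF p x that] pointed_maps_subset[of X Y p] by blast
    ultimately have "bump X p x -` V \<inter> topspace Y =
        (if K \<subseteq> {x} \<or> p \<in> U then if x \<in> K then U else topspace Y else {})"
      using openin_subset[OF U] by (auto simp: V)
    then show "openin Y (bump X p x -` V \<inter> topspace Y)"
      using U by simp
  next
    have "bump X p x ` topspace Y \<subseteq> topspace (compact_open_topology X Y)"
      using bump_in_pointed_maps[OF p x] pointed_maps_subset[of X Y p] by auto
    then show "bump X p x ` topspace Y \<subseteq>
        \<Union> {{f \<in> continuous_maps X Y. f ` K \<subseteq> U} | K U. compactin X K \<and> openin Y U}"
      unfolding compact_open_topology_def topology_generated_by_topspace .
  qed
  then have "continuous_map Y (pointed_function_space X Y p) (bump X p x)"
    unfolding pointed_function_space_eq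
    using bump_in_pointed_maps[OF p x] by (auto simp: continuous_map_in_subtopology)
  then have "retraction_map (pointed_function_space X Y p) Y (\<lambda>f. f x)"
    unfolding retraction_map_def retraction_maps_def
    using eval xX by (intro exI[of _ "bump X p x"]) (auto simp: bump_def)
  then show ?thesis
    using metr metrizable_space_retraction_map_image by blast
qed

text \<open>The base is taken at the constant map \<open>c\<close>. The T1 property makes the
  complement of \<open>q\<close> open, so avoiding the value \<open>q\<close> on a compact
  \<open>L\<close> is a neighbourhood condition on \<open>c\<close>; the support of a basic set
  inside it must contain every isolated point of \<open>L\<close>.\<close>

lemma first_countable_pointed_imp_hemi:
  assumes p: "p \<in> topspace Y" and q: "q \<in> topspace Y" "q \<noteq> p" and "t1_space Y"
    and fc: "first_countable (pointed_function_space X Y p)"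
  shows "hemi_dot_kappa_omega_space X"
proof -
  define c where "c = restrict (\<lambda>_. p) (topspace X)"
  have "continuous_map X Y c"
    by (rule continuous_map_eq[of _ _ "\<lambda>_. p"]) (use p in \<open>auto simp: c_def\<close>)
  then have c: "c \<in> pointed_maps X Y p"
    by (auto simp: c_def pointed_maps_def continuous_maps_def nonisolated_points_def)
  obtain \<B> where \<B>: "countable \<B>" "\<And>V. V \<in> \<B> \<Longrightarrow> openin (pointed_function_space X Y p) V"
    "\<And>U. \<lbrakk>openin (pointed_function_space X Y p) U; c \<in> U\<rbrakk> \<Longrightarrow> \<exists>V\<in>\<B>. c \<in> V \<and> V \<subseteq> U"
    using fc c unfolding first_countable_def by (metis topspace_pointed_function_space)
  \<comment> \<open>The guard \<open>c \<in> V\<close> makes the choice of \<open>K\<close> total on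
    \<open>\<B>\<close>: members missing \<open>c\<close> receive the empty set.\<close>
  have "\<exists>K. compactin X K \<and> (c \<in> V \<longrightarrow>
      (\<forall>g\<in>pointed_maps X Y p. (\<forall>x\<in>K. g x = c x) \<longrightarrow> g \<in> V))" if V: "V \<in> \<B>" for V
  proof (cases "c \<in> V")
    case True
    obtain W where W: "openin (compact_open_topology X Y) W" "V = W \<inter> pointed_maps X Y p"
      using \<B>(2)[OF V] unfolding pointed_function_space_eq openin_subtopology by blast
    then show ?thesis
      using openin_compact_open_imp_compact_support[OF W(1), of c] True
        pointed_maps_subset[of X Y p] by blast
  next
    case False
    then show ?thesis
      by (intro exI[of _ "{}"]) simp
  qed
  then obtain K where K: "\<And>V. V \<in> \<B> \<Longrightarrow> compactin X (K V)"
    "\<And>V g. \<lbrakk>V \<in> \<B>; c \<in> V; g \<in> pointed_maps X Y p; \<And>x. x \<in> K V \<Longrightarrow> g x = c x\<rbrakk> \<Longrightarrow> g \<in> V"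
    by metis
  \<comment> \<open>Needed for \<open>from_nat_into\<close> to enumerate exactly
    \<open>\<B>\<close>.\<close>
  have "\<B> \<noteq> {}"
    using \<B>(3)[OF openin_topspace] c by auto
  then have range: "range (from_nat_into \<B>) = \<B>"
    using \<B>(1) by (rule range_from_nat_into)
  have "\<exists>n. L \<inter> isolated_points X \<subseteq> K (from_nat_into \<B> n)" if L: "compactin X L" for L
  proof -
    define U where "U = topspace Y - {q}"
    have "openin Y U"
      unfolding U_def using \<open>t1_space Y\<close> q by (simp add: t1_space_openin_delete_alt)
    then have "openin (pointed_function_space X Y p)
        (pointed_maps X Y p \<inter> {f \<in> continuous_maps X Y. f ` L \<subseteq> U})"
      unfolding pointed_function_space_eq using L
      by (intro openin_subtopology_Int2 openin_compact_open_subbase)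
    moreover have "c \<in> pointed_maps X Y p \<inter> {f \<in> continuous_maps X Y. f ` L \<subseteq> U}"
      using c pointed_maps_subset[of X Y p] compactin_subset_topspace[OF L] p q
      by (auto simp: c_def U_def)
    ultimately obtain V where V: "V \<in> \<B>" "c \<in> V" "V \<subseteq> {f \<in> continuous_maps X Y. f ` L \<subseteq> U}"
      using \<B>(3) by (meson inf.boundedE)
    have "x \<in> K V" if x: "x \<in> L" "x \<in> isolated_points X" for x
    proof (rule ccontr)
      assume "x \<notin> K V"
      \<comment> \<open>The bump differs from \<open>c\<close> only at \<open>x\<close>, which lies
        outside \<open>K V\<close>, so \<open>V\<close> cannot exclude it although it takes the
        forbidden value \<open>q\<close> on \<open>L\<close>.\<close>
      then have "bump X p x q \<in> V"
        using K(1)[OF V(1), THEN compactin_subset_topspace]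
        by (intro K(2)[OF V(1,2) bump_in_pointed_maps[OF p x(2) q(1)]]) (auto simp: bump_def c_def)
      then have "bump X p x q x \<in> U"
        using V x by blast
      then show False
        using x isolated_points_subset[of X] by (auto simp: bump_def U_def)
    qed
    then show ?thesis
      using range V(1) by (metis IntE imageE subsetI)
  qed
  then show ?thesis
    unfolding hemi_dot_kappa_omega_space_def
    using K(1) range by (intro exI[of _ "\<lambda>n. K (from_nat_into \<B> n)"]) blast
qed

text \<open>The metric topology of \<open>D\<close> and the function space topology are shown to
  have the same open sets. One inclusion uses that each compact trace lies in a single
  \<open>K n\<close>, the other that only finitely many \<open>K n\<close> matter at a given
  scale.\<close>

lemma (in Metric_space) metrizable_pointed_function_space:
  assumes "hemi_dot_kappa_omega_space X"
  shows "metrizable_space (pointed_function_space X mtopology p)"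
proof -
  obtain K :: "nat \<Rightarrow> 'b set" where K: "\<And>n. compactin X (K n)"
    "\<And>L. compactin X L \<Longrightarrow> \<exists>n. L \<inter> isolated_points X \<subseteq> K n"
    using assms unfolding hemi_dot_kappa_omega_space_def by blast
  define C where "C = pointed_maps X mtopology p"
  define D where "D = truncated_sup_dist d K"
  have KX: "K n \<subseteq> topspace X" for n
    using K(1) by (rule compactin_subset_topspace)
  have CM: "f x \<in> M" if "f \<in> C" "x \<in> topspace X" for f x
    using that by (auto simp: C_def pointed_maps_def continuous_maps_def continuous_map_def)
  have C_nonisolated: "f x = p" if "f \<in> C" "x \<in> topspace X" "x \<notin> isolated_points X" for f x
    using that by (auto simp: C_def pointed_maps_def nonisolated_points_def)
  have "Metric_space C D"
    unfolding D_def
  proof (rule Metric_space_truncated_sup_dist)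
    show "f x \<in> M" if "f \<in> C" "x \<in> K n" for f n x
      using that CM KX by blast
    fix f g
    assume fg: "f \<in> C" "g \<in> C" and eq: "\<And>n x. x \<in> K n \<Longrightarrow> f x = g x"
    show "f = g"
    proof (rule extensionalityI)
      show "f \<in> extensional (topspace X)" "g \<in> extensional (topspace X)"
        using fg by (auto simp: C_def pointed_maps_def continuous_maps_def)
      fix x
      assume x: "x \<in> topspace X"
      show "f x = g x"
      proof (cases "x \<in> isolated_points X")
        case True
        \<comment> \<open>Singletons are compact, so the sets \<open>K n\<close> cover all isolated
          points.\<close>
        then obtain n where "x \<in> K n"
          using K(2)[of "{x}"] x by auto
        then show ?thesis by (rule eq)
      next
        case False
        then show ?thesis
          using C_nonisolated[OF fg(1) x] C_nonisolated[OF fg(2) x] by simp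
      qed
    qed
  qed
  then interpret D: Metric_space C D .
  \<comment> \<open>Stated as continuity of the identity, this inclusion needs checking on subbasic
    sets only.\<close>
  have to_compact_open: "continuous_map D.mtopology (compact_open_topology X mtopology) id"
    unfolding compact_open_topology_def
  proof (rule continuous_on_generated_topo)
    fix V
    assume "V \<in> {{f \<in> continuous_maps X mtopology. f ` L \<subseteq> U} | L U.
      compactin X L \<and> openin mtopology U}"
    then obtain L U where V: "V = {f \<in> continuous_maps X mtopology. f ` L \<subseteq> U}"
      and L: "compactin X L" and U: "openin mtopology U"
      by blast
    have LX: "L \<subseteq> topspace X"
      using L by (rule compactin_subset_topspace)
    have "\<exists>r>0. D.mball f r \<subseteq> C \<inter> V" if f: "f \<in> C" "f \<in> V" for f
    proof -
      have "compactin mtopology (f ` L)"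
        using L by (rule image_compactin) (use f V in \<open>auto simp: continuous_maps_def\<close>)
      then obtain e where e: "e > 0" "\<And>y. y \<in> f ` L \<Longrightarrow> mball y e \<subseteq> U"
        by (rule compactin_mball_nbhd[OF _ U]) (use f V in auto)
      obtain n where n: "L \<inter> isolated_points X \<subseteq> K n"
        using K(2) L by blast
      \<comment> \<open>Below the level \<open>inverse (real (Suc n))\<close> the truncation on
        \<open>K n\<close> is inactive, so \<open>D f g < r\<close> bounds the actual distance
        \<open>d (f x) (g x)\<close> by \<open>e\<close> there.\<close>
      define r where "r = min e (inverse (real (Suc n)))"
      have "g \<in> V" if g: "g \<in> C" "D f g < r" for g
      proof -
        have "g x \<in> U" if x: "x \<in> L" for x
        proof (cases "x \<in> isolated_points X")
          case True
          then have "min (inverse (real (Suc n))) (d (f x) (g x)) < r"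
            using truncated_sup_dist_upper[of x K n d f g] n x g by (auto simp: D_def)
          then have "d (f x) (g x) < e"
            by (auto simp: r_def min_def split: if_splits)
          then have "g x \<in> mball (f x) e"
            using CM f g x LX by auto
          then show ?thesis
            using e x by blast
        next
          case False
          then have "g x = f x"
            using C_nonisolated[OF f(1), of x] C_nonisolated[OF g(1), of x] x LX by auto
          then show ?thesis
            using f V x by auto
        qed
        then show ?thesis
          using g subsetD[OF pointed_maps_subset] by (auto simp: V C_def)
      qed
      moreover have "r > 0"
        using e by (simp add: r_def)
      ultimately show ?thesis
        by (intro exI[of _ r]) auto
    qed
    then have "openin D.mtopology (C \<inter> V)"
      unfolding D.openin_mtopology by blast
    then show "openin D.mtopology (id -` V \<inter> topspace D.mtopology)"
      by (simp add: Int_commute)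
  next
    have "id ` topspace D.mtopology \<subseteq> topspace (compact_open_topology X mtopology)"
      using pointed_maps_subset[of X mtopology p] by (simp flip: C_def)
    then show "id ` topspace D.mtopology \<subseteq>
        \<Union> {{f \<in> continuous_maps X mtopology. f ` L \<subseteq> U} | L U.
          compactin X L \<and> openin mtopology U}"
      unfolding compact_open_topology_def topology_generated_by_topspace .
  qed
  have "openin (pointed_function_space X mtopology p) W" if W: "openin D.mtopology W" for W
  proof (subst openin_subopen, intro ballI)
    fix f
    assume "f \<in> W"
    then obtain r where r: "r > 0" "D.mball f r \<subseteq> W"
      using W unfolding D.openin_mtopology by blast
    have f: "f \<in> C"
      using W \<open>f \<in> W\<close> unfolding D.openin_mtopology by blast
    \<comment> \<open>From index \<open>N\<close> on, the truncation alone keeps the terms below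
      \<open>r / 2\<close>; uniform closeness is required only on the compact union of the
      \<open>K n\<close> with \<open>n \<le> N\<close>.\<close>
    obtain N where N: "inverse (real (Suc N)) < r / 2"
      using r reals_Archimedean[of "r / 2"] by auto
    have "compactin X (\<Union>n\<le>N. K n)"
      using K(1) by (intro compactin_Union) auto
    then obtain V where V: "openin (compact_open_topology X mtopology) V" "f \<in> V"
      "\<And>g x. g \<in> V \<Longrightarrow> x \<in> (\<Union>n\<le>N. K n) \<Longrightarrow> d (f x) (g x) < r / 2"
      by (rule uniform_nbhd_compact_open[of f X _ "r / 2", rotated])
        (use r f subsetD[OF pointed_maps_subset] in \<open>auto simp: C_def\<close>)
    have "V \<inter> C \<subseteq> W"
    proof
      fix g
      assume g: "g \<in> V \<inter> C"
      \<comment> \<open>A supremum of terms below \<open>r / 2\<close> is only bounded weakly, hence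
        the halving to reach the open ball of radius \<open>r\<close>.\<close>
      have "D f g \<le> r / 2"
        unfolding D_def
      proof (rule truncated_sup_dist_least)
        show "0 \<le> r / 2"
          using r by simp
        fix n x
        assume x: "x \<in> K n"
        show "min (inverse (real (Suc n))) (d (f x) (g x)) \<le> r / 2"
        proof (cases "n \<le> N")
          case True
          then have "d (f x) (g x) < r / 2"
            using V(3) g x by blast
          then show ?thesis by simp
        next
          case False
          then have "inverse (real (Suc n)) \<le> inverse (real (Suc N))"
            by (simp add: field_simps)
          then show ?thesis
            using N by (intro min.coboundedI1) linarith
        qed
      qed
      then have "g \<in> D.mball f r"
        using f g r by auto
      then show "g \<in> W"
        using r by blast
    qed
    then show "\<exists>T. openin (pointed_function_space X mtopology p) T \<and> f \<in> T \<and> T \<subseteq> W"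
      using V f unfolding pointed_function_space_eq C_def[symmetric]
      by (intro exI[of _ "V \<inter> C"]) (auto intro: openin_subtopology_Int)
  qed
  moreover have "openin D.mtopology W" if "openin (pointed_function_space X mtopology p) W" for W
  proof -
    obtain V where V: "openin (compact_open_topology X mtopology) V" "W = V \<inter> C"
      using \<open>openin (pointed_function_space X mtopology p) W\<close>
      unfolding pointed_function_space_eq openin_subtopology C_def by blast
    have "openin D.mtopology {f \<in> topspace D.mtopology. id f \<in> V}"
      by (rule openin_continuous_map_preimage[OF to_compact_open V(1)])
    moreover have "{f \<in> topspace D.mtopology. id f \<in> V} = W"
      using V by auto
    ultimately show ?thesis by simp
  qed
  ultimately have "pointed_function_space X mtopology p = D.mtopology"
    unfolding topology_eq by blast
  then show ?thesis
    using D.metrizable_space_mtopology by simp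
qed

theorem theorem7p4:
  fixes X :: "'a topology" and Y :: "'b topology" and p :: 'b
  assumes "p \<in> topspace Y"
    and "\<exists>y\<in>topspace Y. \<exists>z\<in>topspace Y. y \<noteq> z"
    and "isolated_points X \<noteq> {}"
  shows "metrizable_space (pointed_function_space X Y p) \<longleftrightarrow>
    metrizable_space Y \<and> hemi_dot_kappa_omega_space X"
proof
  assume metr: "metrizable_space (pointed_function_space X Y p)"
  \<comment> \<open>Of two distinct points of \<open>Y\<close>, at least one differs from
    \<open>p\<close>.\<close>
  obtain q where q: "q \<in> topspace Y" "q \<noteq> p"
    using assms(2) by metis
  have "metrizable_space Y"
    using metrizable_pointed_imp_metrizable_target[OF assms(1) _ metr] assms(3) by blast
  moreover from this have "t1_space Y"
    by (simp add: metrizable_imp_Hausdorff_space Hausdorff_imp_t1_space)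
  then have "hemi_dot_kappa_omega_space X"
    by (rule first_countable_pointed_imp_hemi[OF assms(1) q])
      (rule metrizable_imp_first_countable[OF metr])
  ultimately show "metrizable_space Y \<and> hemi_dot_kappa_omega_space X"
    by blast
next
  assume "metrizable_space Y \<and> hemi_dot_kappa_omega_space X"
  then obtain M d where "Metric_space M d" "Y = Metric_space.mtopology M d"
      "hemi_dot_kappa_omega_space X"
    unfolding metrizable_space_def by blast
  then show "metrizable_space (pointed_function_space X Y p)"
    by (simp add: Metric_space.metrizable_pointed_function_space)
qed

end
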